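(* Let $\mathcal{G}$ be the space of future distributions of a stationary discrete-time stochastic process with values in a countable set $\mathcal{O}$, and let $\|\cdot\|$ be any norm on $\mathcal{G}$. Then $(\mathcal{G},\|\cdot\|)$ is complete if and only if $\mathcal{G}$ is finite-dimensional.
   Context: Let $\mathcal{O}$ be a (nonempty) countable set and let $(X_t)_{t\in\mathbb{Z}}$ be a stationary stochastic process with values in $\mathcal{O}$, i.e. $\mathbb{P}(X_{t_1}=x_1,\dots,X_{t_k}=x_k)=\mathbb{P}(X_{t_1+l}=x_1,\dots,X_{t_k+l}=x_k)$ for all times $t_1,\dots,t_k\in\mathbb{Z}$, all $x_i\in\mathcal{O}$ and all $l\in\mathbb{Z}$. Let $\mathcal{O}^{+}=\bigcup_{i\ge 1}\mathcal{O}^i$ and $\mathcal{O}^{*}=\mathcal{O}^{+}\cup\{\epsilon\}$, where $\epsilon$ is the empty string. For $\bar a=x_1\cdots x_k\in\mathcal{O}^k$ write $\mathbb{P}(\bar a)=\mathbb{P}(X_{1}=x_1,\dots,X_{k}=x_k)$, and $\mathbb{P}(\epsilon)=1$. Concatenation of strings is written $\bar a\bar b$, and $\mathbb{P}(\bar b\mid\bar a)=\mathbb{P}(\bar a\bar b)/\mathbb{P}(\bar a)$ if $\mathbb{P}(\bar a)\neq 0$ (the probability of $\bar b$ directly following $\bar a$). For each $\bar a\in\mathcal{O}^{*}$ define $g_{\bar a}:\mathcal{O}^{*}\to\mathbb{R}$ by $g_{\bar a}(\bar b)=\mathbb{P}(\bar b\mid\bar a)$ if $\mathbb{P}(\bar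 a)\neq 0$ (so $g_{\bar a}(\epsilon)=1$), and $g_{\bar a}\equiv 0$ if $\mathbb{P}(\bar a)=0$. The space of future distributions $\mathcal{G}$ is the real vector space of all finite linear combinations of the functions $g_{\bar a}$, $\bar a\in\mathcal{O}^{*}$, with pointwise operations. *)

theory Defs
  imports "HOL-Probability.Probability" "HOL-Library.Function_Algebras"
begin

text \<open>
  Real-valued functions with pointwise operations form a real vector space; addition and zero are
  the pointwise ones of \<^theory>\<open>HOL-Library.Function_Algebras\<close>.
\<close>

instantiation "fun" :: (type, real_vector) real_vector
begin

definition scaleR_fun :: "real \<Rightarrow> ('a \<Rightarrow> 'b) \<Rightarrow> 'a \<Rightarrow> 'b"
  where "scaleR_fun c f = (\<lambda>x. c *\<^sub>R f x)"

instance
  by standard (auto simp: scaleR_fun_def fun_eq_iff scaleR_add_right scaleR_add_left)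

end

definition stationary_process :: "'w measure \<Rightarrow> 'o set \<Rightarrow> (int \<Rightarrow> 'w \<Rightarrow> 'o) \<Rightarrow> bool"
  where "stationary_process M \<O> X \<longleftrightarrow>
    prob_space M \<and>
    (\<forall>t. X t \<in> M \<rightarrow>\<^sub>M count_space \<O>) \<and>
    (\<forall>ts xs l. xs \<in> lists \<O> \<and> length ts = length xs \<longrightarrow>
       measure M {\<omega> \<in> space M. \<forall>i<length xs. X (ts ! i) \<omega> = xs ! i} =
       measure M {\<omega> \<in> space M. \<forall>i<length xs. X (ts ! i + l) \<omega> = xs ! i})"

text \<open>
  Strings over \<open>\<O>\<close> are the elements of \<^term>\<open>lists \<O>\<close>.  The letter \<open>a ! i\<close>
  is read at time \<open>i + 1\<close>, as list indices start at \<open>0\<close>.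
\<close>

definition string_prob :: "'w measure \<Rightarrow> (int \<Rightarrow> 'w \<Rightarrow> 'o) \<Rightarrow> 'o list \<Rightarrow> real"
  where "string_prob M X a =
    measure M {\<omega> \<in> space M. \<forall>i<length a. X (int i + 1) \<omega> = a ! i}"

text \<open>
  A function on strings over \<open>\<O>\<close> is represented by its extension by zero to all lists, so that
  equality of functions is equality on \<^term>\<open>lists \<O>\<close>.
\<close>

definition future_dist ::
    "'w measure \<Rightarrow> 'o set \<Rightarrow> (int \<Rightarrow> 'w \<Rightarrow> 'o) \<Rightarrow> 'o list \<Rightarrow> 'o list \<Rightarrow> real"
  where "future_dist M \<O> X a = (\<lambda>b.
    if b \<in> lists \<O> \<and> string_prob M X a \<noteq> 0
    then string_prob M X (a @ b) / string_prob M X a else 0)"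

definition future_space :: "'w measure \<Rightarrow> 'o set \<Rightarrow> (int \<Rightarrow> 'w \<Rightarrow> 'o) \<Rightarrow> ('o list \<Rightarrow> real) set"
  where "future_space M \<O> X = span (future_dist M \<O> X ` lists \<O>)"

definition finite_dimensional :: "'a::real_vector set \<Rightarrow> bool"
  where "finite_dimensional V \<longleftrightarrow> (\<exists>B. finite B \<and> span B = V)"

text \<open>
  The type class \<^class>\<open>real_normed_vector\<close> would fix one norm on a whole type; here an arbitrary
  norm on a subspace \<open>V\<close> is needed, and the values of \<open>N\<close> outside \<open>V\<close> are irrelevant.
\<close>

definition norm_on :: "'a::real_vector set \<Rightarrow> ('a \<Rightarrow> real) \<Rightarrow> bool"
  where "norm_on V N \<longleftrightarrow>
    (\<forall>v\<in>V. 0 \<le> N v) \<and>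
    (\<forall>v\<in>V. N v = 0 \<longleftrightarrow> v = 0) \<and>
    (\<forall>c. \<forall>v\<in>V. N (c *\<^sub>R v) = \<bar>c\<bar> * N v) \<and>
    (\<forall>v\<in>V. \<forall>w\<in>V. N (v + w) \<le> N v + N w)"

text \<open>
  The distance is set to zero off \<open>V\<close> because \<^locale>\<open>Metric_space\<close> requires nonnegativity and
  symmetry on the whole type, not just on the carrier.
\<close>

definition norm_dist :: "'a::real_vector set \<Rightarrow> ('a \<Rightarrow> real) \<Rightarrow> 'a \<Rightarrow> 'a \<Rightarrow> real"
  where "norm_dist V N v w = (if v \<in> V \<and> w \<in> V then N (v - w) else 0)"

lemma Metric_space_norm_dist:
  assumes V: "subspace V" and N: "norm_on V N"
  shows "Metric_space V (norm_dist V N)"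
proof -
  have diff: "v - w \<in> V" if "v \<in> V" "w \<in> V" for v w
    using V that by (rule subspace_diff)
  have nonneg: "0 \<le> N v" and zero: "N v = 0 \<longleftrightarrow> v = 0"
    and scale: "N (c *\<^sub>R v) = \<bar>c\<bar> * N v" if "v \<in> V" for v c
    using N that unfolding norm_on_def by simp_all
  have triangle: "N (v + w) \<le> N v + N w" if "v \<in> V" "w \<in> V" for v w
    using N that unfolding norm_on_def by simp
  show ?thesis
  proof
    show "0 \<le> norm_dist V N x y" for x y
      by (simp add: norm_dist_def nonneg diff)
    show "norm_dist V N x y = norm_dist V N y x" for x y
      using scale[OF diff, of y x "-1"] by (simp add: norm_dist_def)
    show "norm_dist V N x y = 0 \<longleftrightarrow> x = y" if "x \<in> V" "y \<in> V" for x y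
      using that by (simp add: norm_dist_def zero diff)
    show "norm_dist V N x z \<le> norm_dist V N x y + norm_dist V N y z"
      if "x \<in> V" "y \<in> V" "z \<in> V" for x y z
      using triangle[OF diff diff, of x y y z] that by (simp add: norm_dist_def)
  qed
qed

definition complete_under :: "'a::real_vector set \<Rightarrow> ('a \<Rightarrow> real) \<Rightarrow> bool"
  where "complete_under V N \<longleftrightarrow> Metric_space.mcomplete V (norm_dist V N)"

end

theory Submission
  imports Defs
begin

text \<open>
  There are only countably many strings over a countable alphabet, so the space of future
  distributions is spanned by countably many vectors.  The equivalence holds for every normed space
  \<open>V = span C\<close> with \<open>C\<close> countable (\<open>complete_iff_finite_dimensional_of_countable_span\<close>).

  A finite-dimensional space is complete under every norm (\<open>complete_under_span_finite\<close>), by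
  induction on a spanning set.  When a vector \<open>b\<close> is added to a complete subspace \<open>W\<close>, it stays at a
  positive distance \<open>\<delta>\<close> from \<open>W\<close>; hence \<open>\<delta> * \<bar>c\<bar> \<le> N (w + c *\<^sub>R b)\<close> for \<open>w \<in> W\<close>, so that the
  \<open>b\<close>-coordinates of a Cauchy sequence are Cauchy, and therefore its \<open>W\<close>-components are too.

  Conversely, \<open>span C\<close> is the union of the countably many spaces \<open>span F\<close> with \<open>F \<subseteq> C\<close> finite.
  Each of them is complete, hence closed, and a proper subspace has empty interior.  If \<open>V\<close> is
  complete, then Baire's theorem forces one of the \<open>span F\<close> to be all of \<open>V\<close>.
\<close>

section \<open>Norms on subspaces\<close>

lemma norm_onD:
  assumes "norm_on V N" and "v \<in> V"
  shows norm_on_nonneg: "0 \<le> N v"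
    and norm_on_eq_0_iff: "N v = 0 \<longleftrightarrow> v = 0"
    and norm_on_scaleR: "N (c *\<^sub>R v) = \<bar>c\<bar> * N v"
  using assms unfolding norm_on_def by simp_all

lemma norm_on_triangle:
  assumes "norm_on V N" and "v \<in> V" and "w \<in> V"
  shows "N (v + w) \<le> N v + N w"
  using assms unfolding norm_on_def by simp

lemma norm_on_minus_commute:
  assumes "subspace V" and "norm_on V N" and "v \<in> V" and "w \<in> V"
  shows "N (v - w) = N (w - v)"
  using norm_on_scaleR[OF assms(2) subspace_diff[OF assms(1,4,3)], of "-1"] by simp

lemma norm_on_diff_triangle:
  assumes "subspace V" and "norm_on V N" and "u \<in> V" and "v \<in> V" and "w \<in> V"
  shows "N (u - w) \<le> N (u - v) + N (v - w)"
  using norm_on_triangle[OF assms(2) subspace_diff[OF assms(1,3,4)] subspace_diff[OF assms(1,4,5)]]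
  by simp

lemma norm_on_subset:
  assumes "norm_on V N" and "W \<subseteq> V"
  shows "norm_on W N"
  using assms by (simp add: norm_on_def subset_iff)

text \<open>
  This form of completeness mentions neither topology nor the off-carrier values of the distance, so
  it is insensitive to whether a sequence is regarded in a subspace or in an ambient space.
\<close>

lemma complete_under_iff:
  assumes V: "subspace V" and N: "norm_on V N"
  shows "complete_under V N \<longleftrightarrow>
    (\<forall>\<sigma>. (\<forall>n::nat. \<sigma> n \<in> V) \<and> (\<forall>e>0. \<exists>K. \<forall>m\<ge>K. \<forall>n\<ge>K. N (\<sigma> m - \<sigma> n) < e) \<longrightarrow>
      (\<exists>l\<in>V. (\<lambda>n. N (\<sigma> n - l)) \<longlonglongrightarrow> 0))"
proof -
  interpret Metric_space V "norm_dist V N"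
    using V N by (rule Metric_space_norm_dist)
  have cauchy: "MCauchy \<sigma> \<longleftrightarrow>
      (\<forall>n. \<sigma> n \<in> V) \<and> (\<forall>e>0. \<exists>K. \<forall>m\<ge>K. \<forall>n\<ge>K. N (\<sigma> m - \<sigma> n) < e)" for \<sigma>
  proof (cases "\<forall>n. \<sigma> n \<in> V")
    case True
    then show ?thesis
      unfolding MCauchy_def norm_dist_def image_subset_iff by simp
  next
    case False
    then show ?thesis
      unfolding MCauchy_def by blast
  qed
  have lim: "limitin mtopology \<sigma> l sequentially \<longleftrightarrow> l \<in> V \<and> (\<lambda>n. N (\<sigma> n - l)) \<longlonglongrightarrow> 0"
    if "\<forall>n. \<sigma> n \<in> V" for \<sigma> l
    using that by (auto simp: limitin_metric_dist_null norm_dist_def)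
  show ?thesis
    unfolding complete_under_def mcomplete_def cauchy using lim by blast
qed

text \<open>
  Otherwise some sequence in \<open>W\<close> would converge to \<open>b\<close>; being Cauchy, it would also have a limit in
  \<open>W\<close>, and limits are unique.
\<close>

lemma complete_subspace_positive_distance:
  assumes V: "subspace V" and N: "norm_on V N"
    and W: "subspace W" "W \<subseteq> V" and complete: "complete_under W N"
    and b: "b \<in> V" "b \<notin> W"
  obtains \<delta> where "\<delta> > 0" and "\<And>w. w \<in> W \<Longrightarrow> \<delta> \<le> N (b - w)"
proof (cases "\<exists>\<delta>>0. \<forall>w\<in>W. \<delta> \<le> N (b - w)")
  case True
  then show ?thesis using that by blast
next
  case False
  then have "\<exists>w\<in>W. N (b - w) < inverse (real (Suc n))" for n
    by (meson inverse_positive_iff_positive linorder_not_le of_nat_0_less_iff zero_less_Suc)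
  then obtain \<sigma> where \<sigma>: "\<And>n. \<sigma> n \<in> W" and near: "\<And>n. N (b - \<sigma> n) < inverse (real (Suc n))"
    by metis
  have \<sigma>V: "\<sigma> n \<in> V" for n
    using \<sigma> W by blast
  have to_b: "(\<lambda>n. N (b - \<sigma> n)) \<longlonglongrightarrow> 0"
  proof (rule tendsto_sandwich[OF _ _ tendsto_const LIMSEQ_inverse_real_of_nat])
    show "\<forall>\<^sub>F n in sequentially. 0 \<le> N (b - \<sigma> n)"
      using norm_on_nonneg[OF N subspace_diff[OF V b(1) \<sigma>V]] by simp
    show "\<forall>\<^sub>F n in sequentially. N (b - \<sigma> n) \<le> inverse (real (Suc n))"
      using near by (simp add: less_imp_le)
  qed
  have "\<exists>K. \<forall>m\<ge>K. \<forall>n\<ge>K. N (\<sigma> m - \<sigma> n) < e" if "e > 0" for e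
  proof -
    obtain K where K: "\<And>n. n \<ge> K \<Longrightarrow> N (b - \<sigma> n) < e / 2"
      using order_tendstoD(2)[OF to_b, of "e / 2"] \<open>e > 0\<close> by (auto simp: eventually_sequentially)
    have "N (\<sigma> m - \<sigma> n) < e" if "m \<ge> K" "n \<ge> K" for m n
      using norm_on_diff_triangle[OF V N \<sigma>V b(1) \<sigma>V, of m n] K[OF that(1)] K[OF that(2)]
        norm_on_minus_commute[OF V N b(1) \<sigma>V, of m] by simp
    then show ?thesis by blast
  qed
  with \<sigma> complete obtain l where l: "l \<in> W" "(\<lambda>n. N (\<sigma> n - l)) \<longlonglongrightarrow> 0"
    using complete_under_iff[OF W(1) norm_on_subset[OF N W(2)]] by blast
  have "(\<lambda>n. N (b - \<sigma> n) + N (\<sigma> n - l)) \<longlonglongrightarrow> 0"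
    using tendsto_add[OF to_b l(2)] by simp
  moreover have "N (b - l) \<le> N (b - \<sigma> n) + N (\<sigma> n - l)" for n
    using norm_on_diff_triangle[OF V N b(1) \<sigma>V, of l n] l(1) W by blast
  ultimately have "N (b - l) \<le> 0"
    by (meson LIMSEQ_le_const)
  moreover have "b - l \<in> V"
    using V b(1) l(1) W by (blast intro: subspace_diff)
  ultimately have "b = l"
    using norm_on_nonneg[OF N] norm_on_eq_0_iff[OF N] by (metis antisym right_minus_eq)
  with l(1) b(2) show ?thesis by simp
qed

section \<open>Finite-dimensional spaces are complete\<close>

text \<open>
  If \<open>b\<close> has distance at least \<open>\<delta>\<close> from \<open>span B\<close>, then \<open>N (w + c *\<^sub>R b) \<ge> \<delta> * \<bar>c\<bar>\<close> for \<open>w\<close> in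
  \<open>span B\<close>: divide by \<open>c\<close>.  So a Cauchy sequence splits into a Cauchy sequence of coordinates along
  \<open>b\<close> and a Cauchy sequence in \<open>span B\<close>, and the two limits recombine.
\<close>

lemma complete_under_span_insert:
  assumes N: "norm_on (span (insert b B)) N" and complete: "complete_under (span B) N"
  shows "complete_under (span (insert b B)) N"
proof (cases "b \<in> span B")
  case True
  then show ?thesis
    using complete by (simp add: span_redundant)
next
  case False
  define V where "V = span (insert b B)"
  define W where "W = span B"
  have V: "subspace V" and W: "subspace W" "W \<subseteq> V" and b: "b \<in> V" "b \<notin> W" and NV: "norm_on V N"
    using False N by (auto simp: V_def W_def span_base span_mono subset_insertI)
  have NW: "norm_on W N"
    using NV W(2) by (rule norm_on_subset)
  obtain \<delta> where \<delta>: "\<delta> > 0" "\<And>w. w \<in> W \<Longrightarrow> \<delta> \<le> N (b - w)"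
    using complete_subspace_positive_distance[OF V NV W] complete b unfolding W_def by metis
  have coordinate: "\<delta> * \<bar>c\<bar> \<le> N (w + c *\<^sub>R b)" if w: "w \<in> W" for w c
  proof (cases "c = 0")
    case True
    then show ?thesis
      using norm_on_nonneg[OF NW w] by simp
  next
    case False
    have w': "(- inverse c) *\<^sub>R w \<in> W"
      using W(1) w by (rule subspace_scale)
    have "w + c *\<^sub>R b = c *\<^sub>R (b - (- inverse c) *\<^sub>R w)"
      using False by (simp add: algebra_simps)
    then have "N (w + c *\<^sub>R b) = \<bar>c\<bar> * N (b - (- inverse c) *\<^sub>R w)"
      using norm_on_scaleR[OF NV, of "b - (- inverse c) *\<^sub>R w" c] V b(1) w' W(2)
      by (metis subsetD subspace_diff)
    then show ?thesis
      using mult_left_mono[OF \<delta>(2)[OF w'] abs_ge_zero, of c] by (simp add: mult.commute)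
  qed
  have "\<exists>l\<in>V. (\<lambda>n. N (\<sigma> n - l)) \<longlonglongrightarrow> 0"
    if \<sigma>: "\<forall>n::nat. \<sigma> n \<in> V" and cauchy: "\<forall>e>0. \<exists>K. \<forall>m\<ge>K. \<forall>n\<ge>K. N (\<sigma> m - \<sigma> n) < e" for \<sigma>
  proof -
    have "\<forall>n. \<exists>k. \<sigma> n - k *\<^sub>R b \<in> W"
      using \<sigma> unfolding V_def W_def by (simp add: span_breakdown_eq)
    then obtain c where w_in: "\<And>n. \<sigma> n - c n *\<^sub>R b \<in> W"
      by metis
    define w where "w n = \<sigma> n - c n *\<^sub>R b" for n
    have w: "w n \<in> W" for n
      using w_in by (simp add: w_def)
    have diff: "\<sigma> m - \<sigma> n = (w m - w n) + (c m - c n) *\<^sub>R b" for m n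
      by (simp add: w_def algebra_simps)
    have "Cauchy c"
      unfolding Cauchy_def
    proof (intro allI impI)
      fix e :: real assume "e > 0"
      then obtain K where K: "\<forall>m\<ge>K. \<forall>n\<ge>K. N (\<sigma> m - \<sigma> n) < \<delta> * e"
        using cauchy \<delta>(1) by (meson mult_pos_pos)
      have "dist (c m) (c n) < e" if "m \<ge> K" "n \<ge> K" for m n
      proof -
        have "\<delta> * \<bar>c m - c n\<bar> \<le> N (\<sigma> m - \<sigma> n)"
          unfolding diff by (rule coordinate[OF subspace_diff[OF W(1) w w]])
        also have "N (\<sigma> m - \<sigma> n) < \<delta> * e"
          using K that by blast
        finally have "\<delta> * \<bar>c m - c n\<bar> < \<delta> * e" .
        then show ?thesis
          using \<delta>(1) by (simp add: dist_real_def)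
      qed
      then show "\<exists>K. \<forall>m\<ge>K. \<forall>n\<ge>K. dist (c m) (c n) < e" by blast
    qed
    then obtain c0 where c0: "c \<longlonglongrightarrow> c0"
      using Cauchy_convergent convergent_def by blast
    have "\<exists>K. \<forall>m\<ge>K. \<forall>n\<ge>K. N (w m - w n) < e" if "e > 0" for e
    proof -
      \<comment> \<open>The \<open>+ 1\<close> keeps the denominator positive; the error from the coordinates is then at most
        \<open>r * N b \<le> e / 2\<close>.\<close>
      define r where "r = e / (2 * (N b + 1))"
      have Nb: "0 \<le> N b"
        using norm_on_nonneg[OF NV b(1)] .
      have "r > 0"
        using \<open>e > 0\<close> Nb by (simp add: r_def)
      have rb: "r * N b \<le> e / 2"
        using \<open>e > 0\<close> Nb by (simp add: r_def field_simps)
      obtain K1 where K1: "\<forall>m\<ge>K1. \<forall>n\<ge>K1. N (\<sigma> m - \<sigma> n) < e / 2"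
        using cauchy \<open>e > 0\<close> by (meson half_gt_zero)
      obtain K2 where K2: "\<forall>m\<ge>K2. \<forall>n\<ge>K2. dist (c m) (c n) < r"
        using \<open>Cauchy c\<close> \<open>r > 0\<close> unfolding Cauchy_def by blast
      have "N (w m - w n) < e" if mn: "m \<ge> max K1 K2" "n \<ge> max K1 K2" for m n
      proof -
        have "w m - w n = (\<sigma> m - \<sigma> n) + (c n - c m) *\<^sub>R b"
          by (simp add: w_def algebra_simps)
        then have "N (w m - w n) \<le> N (\<sigma> m - \<sigma> n) + N ((c n - c m) *\<^sub>R b)"
          using norm_on_triangle[OF NV, of "\<sigma> m - \<sigma> n" "(c n - c m) *\<^sub>R b"] V \<sigma> b(1)
          by (simp add: subspace_diff subspace_scale)
        also have "N ((c n - c m) *\<^sub>R b) = \<bar>c n - c m\<bar> * N b"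
          using NV b(1) by (rule norm_on_scaleR)
        also have "\<bar>c n - c m\<bar> * N b \<le> r * N b"
        proof (rule mult_right_mono[OF _ Nb])
          show "\<bar>c n - c m\<bar> \<le> r"
            using K2 mn by (simp add: dist_real_def less_imp_le)
        qed
        finally show ?thesis
          using K1 mn rb by (smt (verit) field_sum_of_halves max.bounded_iff)
      qed
      then show ?thesis by blast
    qed
    with w complete obtain w0 where w0: "w0 \<in> W" "(\<lambda>n. N (w n - w0)) \<longlonglongrightarrow> 0"
      using complete_under_iff[OF W(1) NW] unfolding W_def by blast
    define l where "l = w0 + c0 *\<^sub>R b"
    have l: "l \<in> V"
      using V W(2) w0(1) b(1) by (auto simp: l_def intro!: subspace_add subspace_scale)
    have "(\<lambda>n. N (\<sigma> n - l)) \<longlonglongrightarrow> 0"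
    proof (rule tendsto_sandwich[OF _ _ tendsto_const])
      show "\<forall>\<^sub>F n in sequentially. 0 \<le> N (\<sigma> n - l)"
        using norm_on_nonneg[OF NV] V \<sigma> l by (simp add: subspace_diff)
      have "N (\<sigma> n - l) \<le> N (w n - w0) + \<bar>c n - c0\<bar> * N b" for n
      proof -
        have "\<sigma> n - l = (w n - w0) + (c n - c0) *\<^sub>R b"
          by (simp add: w_def l_def algebra_simps)
        moreover have "w n - w0 \<in> V" "(c n - c0) *\<^sub>R b \<in> V"
          using V W w w0(1) b(1) by (auto intro: subspace_diff subspace_scale)
        ultimately show ?thesis
          using norm_on_triangle[OF NV] norm_on_scaleR[OF NV b(1)] by metis
      qed
      then show "\<forall>\<^sub>F n in sequentially. N (\<sigma> n - l) \<le> N (w n - w0) + \<bar>c n - c0\<bar> * N b"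
        by simp
      have "(\<lambda>n. \<bar>c n - c0\<bar>) \<longlonglongrightarrow> 0"
        using c0 by (simp add: LIM_zero tendsto_rabs_zero)
      then show "(\<lambda>n. N (w n - w0) + \<bar>c n - c0\<bar> * N b) \<longlonglongrightarrow> 0"
        using w0(2) by (auto intro: tendsto_add_zero tendsto_mult_left_zero)
    qed
    with l show ?thesis by blast
  qed
  then show ?thesis
    using complete_under_iff[OF V NV] unfolding V_def by blast
qed

lemma complete_under_span_finite:
  assumes "finite B" and "norm_on (span B) N"
  shows "complete_under (span B) N"
  using assms
proof (induction B rule: finite_induct)
  case empty
  have "N 0 = 0"
    using empty norm_on_eq_0_iff[of "span {}" N 0] by simp
  then show ?case
    using complete_under_iff[OF subspace_span empty] by simp
next
  case (insert b B)
  have "norm_on (span B) N"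
    using insert.prems by (rule norm_on_subset) (simp add: span_mono subset_insertI)
  then show ?case
    using insert by (intro complete_under_span_insert) auto
qed

section \<open>Countably spanned complete spaces are finite-dimensional\<close>

lemma closedin_complete_subspace:
  assumes V: "subspace V" and N: "norm_on V N"
    and W: "subspace W" "W \<subseteq> V" and complete: "complete_under W N"
  shows "closedin (Metric_space.mtopology V (norm_dist V N)) W"
proof -
  interpret Metric_space V "norm_dist V N"
    using V N by (rule Metric_space_norm_dist)
  have "\<exists>r>0. disjnt W (mball b r)" if b: "b \<in> V - W" for b
  proof -
    obtain \<delta> where "\<delta> > 0" "\<And>w. w \<in> W \<Longrightarrow> \<delta> \<le> N (b - w)"
      using complete_subspace_positive_distance[OF V N W complete, of b] b by blast
    then have "disjnt W (mball b \<delta>)"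
      by (force simp: disjnt_iff norm_dist_def)
    with \<open>\<delta> > 0\<close> show ?thesis by blast
  qed
  then show ?thesis
    using W(2) by (simp add: closedin_metric)
qed

text \<open>
  A subspace that contains a ball around \<open>x\<close> contains a small multiple of every vector \<open>v\<close>, namely
  the difference of the two points \<open>x + t *\<^sub>R v\<close> and \<open>x\<close> of the ball.
\<close>

lemma proper_subspace_interior_empty:
  assumes V: "subspace V" and N: "norm_on V N" and W: "subspace W" "W \<subset> V"
  shows "Metric_space.mtopology V (norm_dist V N) interior_of W = {}"
proof (rule ccontr)
  interpret Metric_space V "norm_dist V N"
    using V N by (rule Metric_space_norm_dist)
  assume "mtopology interior_of W \<noteq> {}"
  then obtain x r where x: "x \<in> V" and r: "r > 0" "mball x r \<subseteq> W"
    using in_interior_of_mball by blast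
  have "v \<in> W" if v: "v \<in> V" for v
  proof -
    \<comment> \<open>Chosen so that \<open>t * N v < r\<close>, also when \<open>N v = 0\<close>.\<close>
    define t where "t = r / (N v + 1)"
    have Nv: "0 \<le> N v"
      using N v by (rule norm_on_nonneg)
    have "t > 0"
      using r(1) Nv by (simp add: t_def)
    have tv: "t *\<^sub>R v \<in> V"
      using V v by (rule subspace_scale)
    have xt: "x + t *\<^sub>R v \<in> V"
      using V x tv by (rule subspace_add)
    have "N (x - (x + t *\<^sub>R v)) = t * N v"
      using norm_on_scaleR[OF N v, of "- t"] \<open>t > 0\<close> by simp
    also have "t * N v < r"
      using r(1) Nv by (simp add: t_def field_simps)
    finally have "x + t *\<^sub>R v \<in> mball x r"
      using x xt by (simp add: norm_dist_def)
    moreover have "x \<in> mball x r"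
      using x r(1) by simp
    ultimately have "(x + t *\<^sub>R v) - x \<in> W"
      using r(2) W(1) by (meson subsetD subspace_diff)
    then have "t *\<^sub>R v \<in> W"
      by simp
    from subspace_scale[OF W(1) this, of "inverse t"] show ?thesis
      using \<open>t > 0\<close> by simp
  qed
  with W(2) show False by blast
qed

lemma span_eq_Union_finite: "span C = \<Union> (span ` {F. finite F \<and> F \<subseteq> C})"
proof
  show "span C \<subseteq> \<Union> (span ` {F. finite F \<and> F \<subseteq> C})"
    unfolding span_explicit by blast
  show "\<Union> (span ` {F. finite F \<and> F \<subseteq> C}) \<subseteq> span C"
    using span_mono by blast
qed

theorem complete_iff_finite_dimensional_of_countable_span:
  assumes C: "countable C" and N: "norm_on (span C) N"
  shows "complete_under (span C) N \<longleftrightarrow> finite_dimensional (span C)"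
proof
  assume "finite_dimensional (span C)"
  then obtain B where "finite B" "span B = span C"
    unfolding finite_dimensional_def by blast
  then show "complete_under (span C) N"
    using N complete_under_span_finite by metis
next
  assume complete: "complete_under (span C) N"
  interpret Metric_space "span C" "norm_dist (span C) N"
    using N by (intro Metric_space_norm_dist) simp_all
  show "finite_dimensional (span C)"
  proof (rule ccontr)
    assume infinite: "\<not> finite_dimensional (span C)"
    \<comment> \<open>Baire's theorem says that \<open>span C\<close>, a countable union of nowhere dense subspaces, would have
      empty interior in itself.\<close>
    have "mtopology interior_of \<Union> (span ` {F. finite F \<and> F \<subseteq> C}) = {}"
    proof (rule metric_Baire_category_alt)
      show "mcomplete"
        using complete by (simp add: complete_under_def)
      show "countable (span ` {F. finite F \<and> F \<subseteq> C})"
        using C by (intro countable_image countable_Collect_finite_subset)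
      fix W assume "W \<in> span ` {F. finite F \<and> F \<subseteq> C}"
      then obtain F where F: "finite F" "F \<subseteq> C" and W: "W = span F"
        by blast
      have "W \<subseteq> span C"
        using F(2) W by (simp add: span_mono)
      moreover have "W \<noteq> span C"
        using infinite F(1) W unfolding finite_dimensional_def by blast
      moreover have "complete_under W N"
        using complete_under_span_finite[OF F(1)] norm_on_subset[OF N \<open>W \<subseteq> span C\<close>] W by simp
      ultimately show "closedin mtopology W \<and> mtopology interior_of W = {}"
        using closedin_complete_subspace[OF subspace_span N, of W]
          proper_subspace_interior_empty[OF subspace_span N, of W] W by auto
    qed
    then have "mtopology interior_of span C = {}"
      by (simp flip: span_eq_Union_finite)
    moreover have "mtopology interior_of span C = span C"
      using interior_of_topspace[of mtopology] by simp
    ultimately show False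
      using span_zero[of C] by simp
  qed
qed

section \<open>The space of future distributions\<close>

theorem theorem5p4:
  fixes M :: "'w measure" and \<O> :: "'o set" and X :: "int \<Rightarrow> 'w \<Rightarrow> 'o"
    and N :: "('o list \<Rightarrow> real) \<Rightarrow> real"
  assumes "countable \<O>" and "\<O> \<noteq> {}"
    and "stationary_process M \<O> X"
    and "norm_on (future_space M \<O> X) N"
  shows "complete_under (future_space M \<O> X) N \<longleftrightarrow> finite_dimensional (future_space M \<O> X)"
proof -
  have "countable (future_dist M \<O> X ` lists \<O>)"
    using assms(1) by simp
  then show ?thesis
    using assms(4) unfolding future_space_def
    by (rule complete_iff_finite_dimensional_of_countable_span)
qed

end
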